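(* Let $G$ be a unimodular locally compact Hausdorff group with right Haar measure $\mu$ (so $\mu$ is also a left Haar measure), let $K$ be a Borel measurable subsemigroup of $G$, and let $\mathfrak{H}$ be a complex Hilbert space. Let $U:K\rightarrow B(\mathfrak{H}):g\mapsto U_{g}$ be such that $\|U_{g}\|\leq 1$ and $U_{g}U_{h}=U_{gh}$ for all $g,h\in K$, and such that $K\ni g\mapsto\langle U_{g}x,y\rangle$ is Borel measurable for all $x,y\in\mathfrak{H}$. Let $P$ be the orthogonal projection of $\mathfrak{H}$ onto the closed subspace $V:=\{x\in\mathfrak{H}:U_{g}x=x\text{ for all }g\in K\}$. Let $\{\Lambda_{\alpha}\}$ be a space-filling net in $K$. Then for any $x,y\in\mathfrak{H}$ and $\varepsilon>0$ there exists an $\alpha_{0}$ such that $$\left|\frac{1}{\mu(\Lambda_{\alpha_{0}})}\int_{h\Lambda_{\alpha_{0}}}\langle x,U_{g}y\rangle\,d\mu(g)\right|>|\langle x,Py\rangle|-\varepsilon$$ for all $h\in K$.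
   Context: $B(\mathfrak{H})$ denotes the algebra of bounded linear operators on $\mathfrak{H}$; inner products are linear in the second slot. A subsemigroup of $G$ is a subset $K\subset G$ (with $K=G$ allowed) such that $gh\in K$ for all $g,h\in K$. A net $\{\Lambda_{\alpha}\}$ is a family of subsets of $G$ indexed by a directed set. A net $\{\Lambda_{\alpha}\}$ of Borel subsets of $G$ is called space-filling in $K$ if $\Lambda_{\alpha}\subset K$ and $\mu(\Lambda_{\alpha})<\infty$ for all $\alpha$, $\mu(\Lambda_{\alpha})>0$ for all $\alpha$ large enough (i.e. for all $\alpha\geq\alpha_{1}$, for some $\alpha_{1}$), and $$\lim_{\alpha}\frac{\mu(\Lambda_{\alpha}\Delta(\Lambda_{\alpha}g))}{\mu(\Lambda_{\alpha})}=0$$ for all $g\in K$, where $A\Delta B:=(A\cup B)\setminus(A\cap B)$, $\Lambda g:=\{kg:k\in\Lambda\}$ and $h\Lambda:=\{hk:k\in\Lambda\}$. Whenever $1/\mu(\Lambda_{\alpha_0})$ is written, it is understood that $\mu(\Lambda_{\alpha_0})>0$. *)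

theory Defs
  imports "HOL-Analysis.Analysis"
begin

section \<open>Complex Hilbert spaces\<close>

class complex_vector = real_vector +
  fixes scaleC :: "complex \<Rightarrow> 'a \<Rightarrow> 'a"  (infixr \<open>*\<^sub>C\<close> 75)
  assumes scaleC_add_right: "c *\<^sub>C (x + y) = c *\<^sub>C x + c *\<^sub>C y"
    and scaleC_add_left: "(c + d) *\<^sub>C x = c *\<^sub>C x + d *\<^sub>C x"
    and scaleC_scaleC: "c *\<^sub>C d *\<^sub>C x = (c * d) *\<^sub>C x"
    and scaleC_of_real: "complex_of_real r *\<^sub>C x = r *\<^sub>R x"

text \<open>The inner product is linear in the second argument. Conjugate symmetry makes \<open>cinner x x\<close>
  real, so that positivity only has to be required of its real part.\<close>

class complex_inner = complex_vector + real_normed_vector +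
  fixes cinner :: "'a \<Rightarrow> 'a \<Rightarrow> complex"
  assumes cinner_commute: "cinner x y = cnj (cinner y x)"
    and cinner_add_right: "cinner x (y + z) = cinner x y + cinner x z"
    and cinner_scaleC_right: "cinner x (c *\<^sub>C y) = c * cinner x y"
    and cinner_ge_zero: "0 \<le> Re (cinner x x)"
    and cinner_eq_zero_iff: "cinner x x = 0 \<longleftrightarrow> x = 0"
    and norm_eq_sqrt_cinner: "norm x = sqrt (Re (cinner x x))"

class complex_hilbert_space = complex_inner + complete_space

instantiation complex :: complex_hilbert_space
begin

definition scaleC_complex_def: "scaleC c x = c * (x :: complex)"

definition cinner_complex_def: "cinner x y = cnj x * (y :: complex)"

instance
  by intro_classes
    (auto simp: scaleC_complex_def cinner_complex_def algebra_simps scaleR_conv_of_real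
      cmod_def power2_eq_square)

end

definition bounded_clinear :: "('a::complex_inner \<Rightarrow> 'b::complex_inner) \<Rightarrow> bool"
  where "bounded_clinear f \<longleftrightarrow>
    bounded_linear f \<and> (\<forall>c x. f (c *\<^sub>C x) = c *\<^sub>C f x)"

definition orthogonal_projection :: "'a::complex_inner set \<Rightarrow> 'a \<Rightarrow> 'a"
  where "orthogonal_projection V x =
    (THE p. p \<in> V \<and> (\<forall>v\<in>V. cinner v (x - p) = 0))"


section \<open>Haar measures\<close>

text \<open>Topological groups are the library's \<^class>\<open>topological_group_add\<close>. This class is written
  additively but does not assume commutativity, so \<open>g + h\<close> stands for the product $gh$ of an
  arbitrary group; in particular \<open>(\<lambda>k. k + g) ` A\<close> is the right translate $Ag$ and
  \<open>(\<lambda>k. g + k) ` A\<close> is the left translate $gA$.\<close>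

definition radon_measure :: "'g::t2_space measure \<Rightarrow> bool"
  where "radon_measure M \<longleftrightarrow>
    sets M = sets borel \<and>
    (\<forall>C. compact C \<longrightarrow> emeasure M C < \<infinity>) \<and>
    (\<forall>A\<in>sets borel. emeasure M A = (INF W\<in>{W. open W \<and> A \<subseteq> W}. emeasure M W)) \<and>
    (\<forall>W. open W \<longrightarrow> emeasure M W = (SUP C\<in>{C. compact C \<and> C \<subseteq> W}. emeasure M C))"

definition right_haar_measure :: "'g::{topological_group_add, t2_space} measure \<Rightarrow> bool"
  where "right_haar_measure M \<longleftrightarrow>
    radon_measure M \<and> emeasure M UNIV \<noteq> 0 \<and>
    (\<forall>g. \<forall>A\<in>sets borel. emeasure M ((\<lambda>k. k + g) ` A) = emeasure M A)"

definition left_haar_measure :: "'g::{topological_group_add, t2_space} measure \<Rightarrow> bool"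
  where "left_haar_measure M \<longleftrightarrow>
    radon_measure M \<and> emeasure M UNIV \<noteq> 0 \<and>
    (\<forall>g. \<forall>A\<in>sets borel. emeasure M ((\<lambda>k. g + k) ` A) = emeasure M A)"

definition unimodular :: "'g::{topological_group_add, t2_space} itself \<Rightarrow> bool"
  where "unimodular (_ :: 'g itself) \<longleftrightarrow>
    (\<forall>M :: 'g measure. right_haar_measure M \<longrightarrow> left_haar_measure M)"

definition subsemigroup :: "'g::topological_group_add set \<Rightarrow> bool"
  where "subsemigroup K \<longleftrightarrow> (\<forall>g\<in>K. \<forall>h\<in>K. g + h \<in> K)"


section \<open>Space-filling nets\<close>

text \<open>\<open>(a, b) \<in> r\<close> is read as $a \le b$.\<close>

definition directed_set :: "'i set \<Rightarrow> 'i rel \<Rightarrow> bool"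
  where "directed_set I r \<longleftrightarrow>
    I \<noteq> {} \<and> preorder_on I r \<and> (\<forall>a\<in>I. \<forall>b\<in>I. \<exists>c\<in>I. (a, c) \<in> r \<and> (b, c) \<in> r)"

definition net_filter :: "'i set \<Rightarrow> 'i rel \<Rightarrow> 'i filter"
  where "net_filter I r = (INF a\<in>I. principal {b\<in>I. (a, b) \<in> r})"

lemma eventually_net_filter:
  assumes "directed_set I r"
  shows "eventually Q (net_filter I r) \<longleftrightarrow> (\<exists>a\<in>I. \<forall>b\<in>I. (a, b) \<in> r \<longrightarrow> Q b)"
proof -
  have tr: "trans r" and ne: "I \<noteq> {}"
    using assms by (auto simp: directed_set_def preorder_on_def)
  have "eventually Q (net_filter I r) \<longleftrightarrow>
      (\<exists>a\<in>I. eventually Q (principal {b\<in>I. (a, b) \<in> r}))"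
    unfolding net_filter_def
  proof (rule eventually_INF_base[OF ne])
    fix a b assume "a \<in> I" "b \<in> I"
    then obtain c where "c \<in> I" "(a, c) \<in> r" "(b, c) \<in> r"
      using assms by (auto simp: directed_set_def)
    then show "\<exists>x\<in>I. principal {b \<in> I. (x, b) \<in> r}
        \<le> inf (principal {b \<in> I. (a, b) \<in> r}) (principal {ba \<in> I. (b, ba) \<in> r})"
      using tr by (auto intro!: bexI[of _ c] dest: transD)
  qed
  then show ?thesis by (auto simp: eventually_principal)
qed

definition space_filling ::
    "'g::{topological_group_add, t2_space} measure \<Rightarrow> 'g set \<Rightarrow> 'i set \<Rightarrow> 'i rel \<Rightarrow> ('i \<Rightarrow> 'g set) \<Rightarrow> bool"
  where "space_filling \<mu> K I r \<Lambda> \<longleftrightarrow>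
    directed_set I r \<and>
    (\<forall>\<alpha>\<in>I. \<Lambda> \<alpha> \<in> sets borel \<and> \<Lambda> \<alpha> \<subseteq> K \<and> emeasure \<mu> (\<Lambda> \<alpha>) < \<infinity>) \<and>
    (\<forall>\<^sub>F \<alpha> in net_filter I r. emeasure \<mu> (\<Lambda> \<alpha>) > 0) \<and>
    (\<forall>g\<in>K. ((\<lambda>\<alpha>. measure \<mu> ((\<Lambda> \<alpha> \<union> (\<lambda>k. k + g) ` \<Lambda> \<alpha>) - (\<Lambda> \<alpha> \<inter> (\<lambda>k. k + g) ` \<Lambda> \<alpha>))
        / measure \<mu> (\<Lambda> \<alpha>)) \<longlongrightarrow> 0) (net_filter I r))"

end

theory Submission
  imports Defs
begin

text \<open>By left invariance of \<open>\<mu>\<close>, the integral of \<open>\<langle>x, U\<^sub>g y\<rangle>\<close> over \<open>h \<Lambda>\<close> is the integral of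
  \<open>\<langle>x, U\<^sub>h U\<^sub>g y\<rangle>\<close> over \<open>\<Lambda>\<close>. Split \<open>y = p + w\<close> with \<open>p = P y\<close>; the first part contributes exactly
  \<open>\<langle>x, p\<rangle>\<close> to every average. For \<open>w = v - U\<^sub>k v\<close>, right invariance turns the integral into a
  difference of integrals over \<open>\<Lambda>\<close> and \<open>\<Lambda> k\<close>, so the average is at most
  \<open>\<parallel>x\<parallel> \<parallel>v\<parallel> \<mu>(\<Lambda> \<Delta> \<Lambda> k) / \<mu>(\<Lambda>)\<close>, whatever \<open>h\<close> is. The vectors \<open>w\<close> orthogonal to the fixed vectors
  whose averages tend to 0 uniformly in \<open>h\<close> form a closed subspace; for contractions, anything
  orthogonal to all \<open>v - U\<^sub>k v\<close> is fixed, so this subspace is the whole orthogonal complement.\<close>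

section \<open>Complex inner product spaces\<close>

lemma cinner_add_left: "cinner (x + y) z = cinner x z + cinner (y :: 'a::complex_inner) z"
  by (metis cinner_add_right cinner_commute complex_cnj_add)

lemma cinner_scaleC_left: "cinner (c *\<^sub>C x) y = cnj c * cinner (x :: 'a::complex_inner) y"
  by (metis cinner_commute cinner_scaleC_right complex_cnj_mult)

lemma cinner_scaleR_right: "cinner x (t *\<^sub>R y) = of_real t * cinner x (y :: 'a::complex_inner)"
  by (metis cinner_scaleC_right scaleC_of_real)

lemma cinner_diff_right: "cinner x (y - z) = cinner x y - cinner x (z :: 'a::complex_inner)"
  using cinner_add_right[of x "y - z" z] by simp

lemma cinner_diff_left: "cinner (x - y) z = cinner x z - cinner (y :: 'a::complex_inner) z"
  using cinner_add_left[of "x - y" y z] by simp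

lemma cinner_zero_right [simp]: "cinner x (0 :: 'a::complex_inner) = 0"
  using cinner_diff_right[of x 0 0] by simp

lemma cinner_self: "cinner x x = of_real ((norm (x :: 'a::complex_inner))\<^sup>2)"
proof -
  have "Im (cinner x x) = 0"
    using arg_cong[OF cinner_commute[of x x], of Im] by simp
  moreover have "Re (cinner x x) = (norm x)\<^sup>2"
    by (simp add: norm_eq_sqrt_cinner cinner_ge_zero)
  ultimately show ?thesis by (simp add: complex_eq_iff)
qed

lemma Re_cinner_commute: "Re (cinner y x) = Re (cinner x (y :: 'a::complex_inner))"
  by (subst cinner_commute) simp

lemma Re_cinner_self: "Re (cinner x x) = (norm (x :: 'a::complex_inner))\<^sup>2"
  by (simp only: cinner_self Re_complex_of_real)

lemma norm_add_square:
  "(norm (x + y))\<^sup>2 = (norm x)\<^sup>2 + 2 * Re (cinner x y) + (norm (y :: 'a::complex_inner))\<^sup>2"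
proof -
  have "(norm (x + y))\<^sup>2 = Re (cinner (x + y) (x + y))"
    by (simp only: Re_cinner_self)
  then show ?thesis
    by (simp add: cinner_add_left cinner_add_right Re_cinner_self Re_cinner_commute[of x y])
qed

lemma norm_diff_square:
  "(norm (x - y))\<^sup>2 = (norm x)\<^sup>2 - 2 * Re (cinner x y) + (norm (y :: 'a::complex_inner))\<^sup>2"
proof -
  have "(norm (x - y))\<^sup>2 = Re (cinner (x - y) (x - y))"
    by (simp only: Re_cinner_self)
  then show ?thesis
    by (simp add: cinner_diff_left cinner_diff_right Re_cinner_self Re_cinner_commute[of x y])
qed

text \<open>The class provides homogeneity of the norm only for real scalars. The complex case comes
  from conjugate linearity in the first slot and cnj c * c = |c|^2.\<close>

lemma norm_scaleC: "norm (c *\<^sub>C x) = cmod c * norm (x :: 'a::complex_inner)"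
proof (rule power2_eq_imp_eq)
  have "of_real ((norm (c *\<^sub>C x))\<^sup>2) = (cnj c * c) * cinner x x"
    by (simp only: cinner_self[symmetric] cinner_scaleC_left cinner_scaleC_right mult.assoc mult.left_commute)
  also have "\<dots> = of_real ((cmod c * norm x)\<^sup>2)"
    by (simp only: cinner_self power_mult_distrib of_real_mult complex_norm_square mult.commute)
  finally show "(norm (c *\<^sub>C x))\<^sup>2 = (cmod c * norm x)\<^sup>2"
    by (simp only: of_real_eq_iff)
qed auto

text \<open>A polynomial without constant term that is nowhere negative has a minimum at 0, so its
  derivative there vanishes. Both variational arguments below end with this.\<close>

lemma linear_term_eq_0:
  fixes a b :: real
  assumes "\<And>t. 0 \<le> a * t + b * t\<^sup>2"
  shows "a = 0"
proof (rule ccontr)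
  assume "a \<noteq> 0"
  \<comment> \<open>Any positive \<open>s\<close> above \<open>b\<close> works: at
    \<open>- a / s\<close> the polynomial takes the value \<open>(a / s)\<^sup>2 * (b - s)\<close>,
    which is negative whatever the sign of \<open>b\<close>.\<close>
  define s where "s = \<bar>b\<bar> + 1"
  have s: "s > 0" "b < s" by (auto simp: s_def)
  have "0 \<le> a * (- a / s) + b * (- a / s)\<^sup>2" by (rule assms)
  also have "\<dots> = (a / s)\<^sup>2 * (b - s)"
    using s by (simp add: field_simps power2_eq_square)
  also have "\<dots> < 0"
    using s \<open>a \<noteq> 0\<close> by (intro mult_pos_neg) auto
  finally show False by simp
qed

lemma cinner_cauchy_schwarz: "cmod (cinner x y) \<le> norm x * norm (y :: 'a::complex_inner)"
proof (cases "x = 0")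
  case True
  then show ?thesis by (subst cinner_commute) simp
next
  case False
  define a where "a = cinner x y"
  \<comment> \<open>\<open>t *\<^sub>C x\<close> is the component of \<open>y\<close> along
    \<open>x\<close>; the inequality says that the remainder has nonnegative squared length.\<close>
  define t where "t = a / of_real ((norm x)\<^sup>2)"
  have nx: "(norm x)\<^sup>2 > 0" using False by simp
  have t: "t * of_real ((norm x)\<^sup>2) = a" using False by (simp add: t_def)
  have ta: "cnj t * a = of_real ((cmod a)\<^sup>2 / (norm x)\<^sup>2)"
    by (simp only: t_def of_real_divide complex_norm_square complex_cnj_divide
        complex_cnj_complex_of_real times_divide_eq_left times_divide_eq_right mult.commute)
  have "0 \<le> (norm (t *\<^sub>C x - y))\<^sup>2" by simp
  also have "\<dots> = (norm (t *\<^sub>C x))\<^sup>2 - 2 * Re (cnj t * a) + (norm y)\<^sup>2"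
    by (simp add: norm_diff_square cinner_scaleC_left a_def)
  also have "(norm (t *\<^sub>C x))\<^sup>2 = (cmod a)\<^sup>2 / (norm x)\<^sup>2"
    using False by (simp add: norm_scaleC t_def norm_divide norm_power norm_mult field_simps power2_eq_square)
  finally have "(cmod a)\<^sup>2 / (norm x)\<^sup>2 \<le> (norm y)\<^sup>2"
    unfolding ta by simp
  then have "(cmod a)\<^sup>2 \<le> (norm x * norm y)\<^sup>2"
    using nx by (simp add: field_simps power_mult_distrib)
  then show ?thesis
    unfolding a_def by (rule power2_le_imp_le) simp
qed

lemma tendsto_cinner_right:
  fixes x :: "'a::complex_inner"
  assumes "(f \<longlongrightarrow> l) F"
  shows "((\<lambda>n. cinner x (f n)) \<longlongrightarrow> cinner x l) F"
proof (rule LIM_zero_cancel, rule Lim_null_comparison)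
  show "\<forall>\<^sub>F n in F. norm (cinner x (f n) - cinner x l) \<le> norm x * norm (f n - l)"
    by (simp flip: cinner_diff_right add: cinner_cauchy_schwarz)
  show "((\<lambda>n. norm x * norm (f n - l)) \<longlongrightarrow> 0) F"
    using assms by (intro tendsto_mult_right_zero tendsto_norm_zero LIM_zero)
qed

section \<open>Orthogonal projection onto closed subspaces\<close>

text \<open>The midpoint of two nearly optimal approximants is no better than optimal, so the
  parallelogram law bounds their distance.\<close>

lemma closed_subspace_nearest_point:
  fixes M :: "'a::complex_hilbert_space set"
  assumes "closed M" and "0 \<in> M"
    and add: "\<And>u v. u \<in> M \<Longrightarrow> v \<in> M \<Longrightarrow> u + v \<in> M"
    and scale: "\<And>c v. v \<in> M \<Longrightarrow> c *\<^sub>C v \<in> M"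
  obtains p where "p \<in> M" and "\<And>m. m \<in> M \<Longrightarrow> norm (y - p) \<le> norm (y - m)"
proof -
  define d where "d = (INF m\<in>M. norm (y - m))"
  have bdd: "bdd_below ((\<lambda>m. norm (y - m)) ` M)"
    by (auto intro!: bdd_belowI[of _ 0])
  have d_le: "d \<le> norm (y - m)" if "m \<in> M" for m
    unfolding d_def using that bdd by (rule cINF_lower[rotated])
  have d0: "0 \<le> d"
    unfolding d_def using \<open>0 \<in> M\<close> by (intro cINF_greatest) auto
  have "\<exists>m\<in>M. norm (y - m) < d + 1 / Suc n" for n
  proof -
    have "(INF m\<in>M. norm (y - m)) < d + 1 / Suc n" by (simp add: d_def)
    then show ?thesis using \<open>0 \<in> M\<close> bdd by (subst (asm) cINF_less_iff) auto
  qed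
  then obtain m where m: "\<And>n. m n \<in> M" "\<And>n. norm (y - m n) < d + 1 / Suc n"
    by metis
  have lim: "(\<lambda>n. norm (y - m n)) \<longlonglongrightarrow> d"
  proof (rule tendsto_sandwich[of "\<lambda>_. d" _ _ "\<lambda>n. d + 1 / Suc n"])
    show "(\<lambda>n. d + 1 / Suc n) \<longlonglongrightarrow> d"
      using tendsto_add[OF tendsto_const LIMSEQ_inverse_real_of_nat, of d]
      by (simp add: inverse_eq_divide)
  qed (use d_le m in \<open>auto intro!: always_eventually less_imp_le\<close>)
  have dist_le: "(norm (m i - m j))\<^sup>2 \<le> 2 * ((norm (y - m i))\<^sup>2 - d\<^sup>2) + 2 * ((norm (y - m j))\<^sup>2 - d\<^sup>2)"
    for i j
  proof -
    define c where "c = (1/2 :: real) *\<^sub>R (m i + m j)"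
    have "c \<in> M"
      unfolding c_def by (subst scaleC_of_real[symmetric]) (intro scale add m)
    have eq: "(y - m i) + (y - m j) = 2 *\<^sub>R (y - c)"
      by (simp add: c_def algebra_simps scaleR_2)
    \<comment> \<open>Adding the expansions of the squared sum and the squared difference cancels
      the cross terms, which is the parallelogram law.\<close>
    have "(norm (m i - m j))\<^sup>2 + (norm ((y - m i) + (y - m j)))\<^sup>2
        = 2 * (norm (y - m i))\<^sup>2 + 2 * (norm (y - m j))\<^sup>2"
      using norm_diff_square[of "y - m j" "y - m i"] norm_add_square[of "y - m j" "y - m i"]
      by (simp add: add.commute)
    moreover have "4 * d\<^sup>2 \<le> (norm ((y - m i) + (y - m j)))\<^sup>2"
      unfolding eq using power_mono[OF d_le[OF \<open>c \<in> M\<close>] d0, of 2]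
      by (simp add: power_mult_distrib)
    ultimately show ?thesis by simp
  qed
  have "Cauchy m"
  proof (rule metric_CauchyI)
    fix e :: real assume "e > 0"
    have "(\<lambda>n. (norm (y - m n))\<^sup>2) \<longlonglongrightarrow> d\<^sup>2"
      using lim by (intro tendsto_intros)
    \<comment> \<open>With the margin e^2 / 4, each of the two terms in \<open>dist_le\<close>
      contributes less than e^2 / 2.\<close>
    moreover have "d\<^sup>2 < d\<^sup>2 + e\<^sup>2 / 4" using \<open>e > 0\<close> by simp
    ultimately have "\<forall>\<^sub>F n in sequentially. (norm (y - m n))\<^sup>2 < d\<^sup>2 + e\<^sup>2 / 4"
      by (rule order_tendstoD(2))
    then obtain N where N: "\<And>n. n \<ge> N \<Longrightarrow> (norm (y - m n))\<^sup>2 < d\<^sup>2 + e\<^sup>2 / 4"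
      by (auto simp: eventually_sequentially)
    have "dist (m i) (m j) < e" if "i \<ge> N" "j \<ge> N" for i j
    proof -
      have "(norm (m i - m j))\<^sup>2 < e\<^sup>2"
        using dist_le[of i j] N[OF that(1)] N[OF that(2)] by simp
      then show ?thesis
        using \<open>e > 0\<close> by (auto simp: dist_norm intro: power2_less_imp_less)
    qed
    then show "\<exists>N. \<forall>i\<ge>N. \<forall>j\<ge>N. dist (m i) (m j) < e" by blast
  qed
  then obtain p where p: "m \<longlonglongrightarrow> p"
    by (auto simp: Cauchy_convergent_iff convergent_def)
  have "p \<in> M"
    using closed_sequentially[OF \<open>closed M\<close>] m p by blast
  moreover have "norm (y - p) = d"
  proof (rule LIMSEQ_unique[OF _ lim])
    show "(\<lambda>n. norm (y - m n)) \<longlonglongrightarrow> norm (y - p)"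
      using p by (intro tendsto_intros)
  qed
  ultimately show thesis using that d_le by blast
qed

text \<open>Take the nearest point: moving it inside the subspace cannot decrease the distance to
  first order, and the first-order term is an inner product with \<open>y - p\<close>.\<close>

lemma closed_subspace_projection:
  fixes M :: "'a::complex_hilbert_space set"
  assumes "closed M" and "0 \<in> M"
    and "\<And>u v. u \<in> M \<Longrightarrow> v \<in> M \<Longrightarrow> u + v \<in> M"
    and scale: "\<And>c v. v \<in> M \<Longrightarrow> c *\<^sub>C v \<in> M"
  obtains p where "p \<in> M" and "\<And>m. m \<in> M \<Longrightarrow> cinner m (y - p) = 0"
proof -
  obtain p where p: "p \<in> M" "\<And>m. m \<in> M \<Longrightarrow> norm (y - p) \<le> norm (y - m)"
    using closed_subspace_nearest_point[OF assms] by metis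
  have "cinner m (y - p) = 0" if "m \<in> M" for m
  proof -
    define a where "a = cinner m (y - p)"
    \<comment> \<open>The factor \<open>a\<close> makes the inner product of \<open>z\<close> with
      \<open>y - p\<close> the real number |a|^2, so a variation in a real parameter already
      controls the full complex coefficient.\<close>
    define z where "z = a *\<^sub>C m"
    have z: "z \<in> M" using that scale by (simp add: z_def)
    have Re: "Re (cinner (y - p) z) = (cmod a)\<^sup>2"
    proof -
      have "cinner z (y - p) = of_real ((cmod a)\<^sup>2)"
        unfolding complex_norm_square by (simp add: z_def cinner_scaleC_left a_def mult.commute)
      then show ?thesis by (subst Re_cinner_commute) simp
    qed
    have "0 \<le> (- 2 * (cmod a)\<^sup>2) * t + (norm z)\<^sup>2 * t\<^sup>2" for t :: real
    proof -
      have "p + t *\<^sub>R z \<in> M"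
        by (subst scaleC_of_real[symmetric]) (intro assms p z)
      then have "(norm (y - p))\<^sup>2 \<le> (norm (y - (p + t *\<^sub>R z)))\<^sup>2"
        by (intro power_mono p) auto
      also have "\<dots> = (norm (y - p - t *\<^sub>R z))\<^sup>2" by (simp add: algebra_simps)
      also have "\<dots> = (norm (y - p))\<^sup>2 - 2 * (t * (cmod a)\<^sup>2) + t\<^sup>2 * (norm z)\<^sup>2"
        by (subst norm_diff_square) (simp add: cinner_scaleR_right Re power_mult_distrib)
      finally show ?thesis by (simp add: algebra_simps)
    qed
    then have "- 2 * (cmod a)\<^sup>2 = 0" by (rule linear_term_eq_0)
    then show ?thesis by (simp add: a_def)
  qed
  with p that show thesis by blast
qed

text \<open>The projection is defined by \<open>THE\<close>, so uniqueness has to be shown: two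
  candidates differ by a vector of \<open>V\<close> that is orthogonal to itself.\<close>

lemma orthogonal_projection_eqI:
  assumes "p \<in> V" and "\<And>v. v \<in> V \<Longrightarrow> cinner v (x - p) = 0"
    and diff: "\<And>u v. u \<in> V \<Longrightarrow> v \<in> V \<Longrightarrow> u - v \<in> V"
  shows "orthogonal_projection V x = p"
  unfolding orthogonal_projection_def
proof (rule the_equality)
  fix q assume q: "q \<in> V \<and> (\<forall>v\<in>V. cinner v (x - q) = 0)"
  then have "cinner (q - p) (x - p) - cinner (q - p) (x - q) = 0"
    using assms by simp
  then have "cinner (q - p) (q - p) = 0"
    by (simp flip: cinner_diff_right)
  then show "q = p" by (simp add: cinner_eq_zero_iff)
qed (use assms in auto)

section \<open>Contractions and their fixed vectors\<close>

text \<open>The hypothesis gives Re <w, T w> = ||w||^2, hence ||w - T w||^2 = ||T w||^2 - ||w||^2,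
  and this is at most 0 for a contraction.\<close>

lemma contraction_fixed_if_orthogonal:
  assumes "\<And>v. norm (T v) \<le> norm (v :: 'a::complex_inner)"
    and "cinner w (w - T w) = 0"
  shows "T w = w"
proof -
  have "Re (cinner w (T w)) = (norm w)\<^sup>2"
    using assms(2) by (simp add: cinner_diff_right flip: Re_cinner_self)
  moreover have "(norm (T w))\<^sup>2 \<le> (norm w)\<^sup>2"
    by (intro power_mono assms) auto
  ultimately have "(norm (w - T w))\<^sup>2 \<le> 0"
    by (simp add: norm_diff_square)
  then show ?thesis by simp
qed

text \<open>This says that the adjoint of \<open>T\<close> fixes the fixed vectors of \<open>T\<close>; expanding
  \<open>\<parallel>T (u + t v)\<parallel>\<^sup>2 \<le> \<parallel>u + t v\<parallel>\<^sup>2\<close> to first order in \<open>t\<close> avoids the adjoint.\<close>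

lemma contraction_fixed_orthogonal:
  assumes T: "bounded_clinear T" and "\<And>v. norm (T v) \<le> norm (v :: 'a::complex_inner)"
    and "T u = u"
  shows "cinner u (v - T v) = 0"
proof -
  have re: "Re (cinner u (v - T v)) = 0" for v
  proof -
    \<comment> \<open>Because \<open>T u = u\<close>, the terms ||u||^2 on both sides of the
      contraction inequality cancel and no constant term remains.\<close>
    have "0 \<le> (2 * Re (cinner u (v - T v))) * t + ((norm v)\<^sup>2 - (norm (T v))\<^sup>2) * t\<^sup>2" for t
    proof -
      have "T (u + t *\<^sub>R v) = u + t *\<^sub>R T v"
        using T \<open>T u = u\<close>
        by (simp add: bounded_clinear_def bounded_linear.linear linear_add linear_scale)
      moreover have "(norm (T (u + t *\<^sub>R v)))\<^sup>2 \<le> (norm (u + t *\<^sub>R v))\<^sup>2"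
        by (intro power_mono assms) simp
      ultimately have "2 * (t * Re (cinner u (T v))) + t\<^sup>2 * (norm (T v))\<^sup>2
          \<le> 2 * (t * Re (cinner u v)) + t\<^sup>2 * (norm v)\<^sup>2"
        by (simp add: norm_add_square cinner_scaleR_right power_mult_distrib)
      then show ?thesis
        by (simp add: cinner_diff_right ring_distribs mult_ac)
    qed
    then have "2 * Re (cinner u (v - T v)) = 0" by (rule linear_term_eq_0)
    then show ?thesis by simp
  qed
  \<comment> \<open>The real-part statement for i v is the imaginary-part statement for v.\<close>
  have "\<i> *\<^sub>C v - T (\<i> *\<^sub>C v) = \<i> *\<^sub>C v - \<i> *\<^sub>C T v"
    using T by (simp add: bounded_clinear_def)
  then have "Im (cinner u (v - T v)) = 0"
    using re[of "\<i> *\<^sub>C v"] by (simp add: cinner_diff_right cinner_scaleC_right)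
  with re show ?thesis by (simp add: complex_eq_iff)
qed

section \<open>Integration over translated sets\<close>

lemma image_add_right_eq_vimage: "(\<lambda>k. k + g) ` A = (\<lambda>k. k - g) -` (A :: 'g::group_add set)"
  by (force simp: image_iff)

lemma image_add_left_eq_vimage: "(\<lambda>k. h + k) ` A = (\<lambda>k. - h + k) -` (A :: 'g::group_add set)"
  by (force simp: image_iff add.assoc[symmetric])

lemma borel_measurable_add_right:
  "(\<lambda>k. k + g) \<in> borel_measurable (borel :: 'g::topological_group_add measure)"
  by (intro borel_measurable_continuous_onI continuous_intros)

lemma borel_measurable_add_left:
  "(\<lambda>k. h + k) \<in> borel_measurable (borel :: 'g::topological_group_add measure)"
  by (intro borel_measurable_continuous_onI continuous_intros)

lemma sets_borel_add_right:
  "A \<in> sets borel \<Longrightarrow> (\<lambda>k. k + g) ` A \<in> sets (borel :: 'g::topological_group_add measure)"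
  unfolding image_add_right_eq_vimage
  using measurable_sets[OF borel_measurable_add_right[of "- g"]] by simp

lemma sets_borel_add_left:
  "A \<in> sets borel \<Longrightarrow> (\<lambda>k. h + k) ` A \<in> sets (borel :: 'g::topological_group_add measure)"
  unfolding image_add_left_eq_vimage
  using measurable_sets[OF borel_measurable_add_left[of "- h"]] by simp

text \<open>Invariance on sets is recast as invariance under pushforward, the form that transforms
  integrals. The preimage of a set under translation by \<open>g\<close> is its translate by
  \<open>- g\<close>.\<close>

lemma distr_add_right:
  assumes "right_haar_measure M"
  shows "distr M M (\<lambda>k. k + g) = M"
proof (rule measure_eqI)
  have sets: "sets M = sets borel"
    using assms by (simp add: right_haar_measure_def radon_measure_def)
  have meas: "(\<lambda>k. k + g) \<in> measurable M M"
    using borel_measurable_add_right by (simp add: measurable_cong_sets[OF sets sets])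
  fix A assume A: "A \<in> sets (distr M M (\<lambda>k. k + g))"
  have sp: "space M = UNIV"
    using sets_eq_imp_space_eq[OF sets] by simp
  have "emeasure (distr M M (\<lambda>k. k + g)) A = emeasure M ((\<lambda>k. k + - g) ` A)"
    unfolding image_add_right_eq_vimage using A meas by (simp add: emeasure_distr sp)
  also have "\<dots> = emeasure M A"
    using A assms unfolding right_haar_measure_def by (metis sets sets_distr)
  finally show "emeasure (distr M M (\<lambda>k. k + g)) A = emeasure M A" .
qed simp

lemma distr_add_left:
  assumes "left_haar_measure M"
  shows "distr M M (\<lambda>k. h + k) = M"
proof (rule measure_eqI)
  have sets: "sets M = sets borel"
    using assms by (simp add: left_haar_measure_def radon_measure_def)
  have meas: "(\<lambda>k. h + k) \<in> measurable M M"
    using borel_measurable_add_left by (simp add: measurable_cong_sets[OF sets sets])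
  fix A assume A: "A \<in> sets (distr M M (\<lambda>k. h + k))"
  have sp: "space M = UNIV"
    using sets_eq_imp_space_eq[OF sets] by simp
  have "emeasure (distr M M (\<lambda>k. h + k)) A = emeasure M ((\<lambda>k. - h + k) ` A)"
    unfolding image_add_left_eq_vimage using A meas by (simp add: emeasure_distr sp)
  also have "\<dots> = emeasure M A"
    using A assms by (simp add: sets left_haar_measure_def)
  finally show "emeasure (distr M M (\<lambda>k. h + k)) A = emeasure M A" .
qed simp

text \<open>Reading \<open>M\<close> as its own pushforward gives the change of variables, and
  injectivity pulls the indicator of the image back to that of \<open>A\<close>. Measurability is
  asked for on the image only, since nothing is known about \<open>U\<close> outside
  \<open>K\<close>.\<close>

lemma set_integral_image_measure_preserving:
  fixes f :: "'a \<Rightarrow> 'b::{banach, second_countable_topology}"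
  assumes "distr M M T = M" "T \<in> measurable M M" "inj T" "T ` A \<in> sets M"
    and "set_borel_measurable M (T ` A) f"
  shows "(LINT k : T ` A | M. f k) = (LINT k : A | M. f (T k))"
proof -
  have "(LINT k : T ` A | M. f k) = (LINT k | distr M M T. indicator (T ` A) k *\<^sub>R f k)"
    by (simp add: set_lebesgue_integral_def assms)
  also have "\<dots> = (LINT k | M. indicator (T ` A) (T k) *\<^sub>R f (T k))"
    using assms by (intro integral_distr) (auto simp: set_borel_measurable_def)
  also have "(\<lambda>k. indicator (T ` A) (T k) :: real) = indicator A"
    using \<open>inj T\<close> by (auto simp: indicator_def inj_image_mem_iff)
  finally show ?thesis by (simp add: set_lebesgue_integral_def)
qed

text \<open>The two integrands agree on the intersection, so their difference lives on the symmetric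
  difference, where \<open>C\<close> bounds it.\<close>

lemma set_integral_diff_le_symm_diff:
  fixes f :: "'a \<Rightarrow> 'b::{banach, second_countable_topology}"
  assumes "A \<in> sets M" "B \<in> sets M" "emeasure M A < \<infinity>" "emeasure M B < \<infinity>"
    and f: "set_integrable M A f" "set_integrable M B f"
    and bound: "\<And>k. k \<in> A \<union> B \<Longrightarrow> norm (f k) \<le> C"
  shows "norm ((LINT k : A | M. f k) - (LINT k : B | M. f k)) \<le> C * measure M ((A \<union> B) - (A \<inter> B))"
proof -
  define D where "D = (A \<union> B) - (A \<inter> B)"
  have D: "D \<in> sets M" unfolding D_def using assms by auto
  have "emeasure M D \<le> emeasure M A + emeasure M B"
    using assms by (intro order_trans[OF emeasure_mono emeasure_subadditive]) (auto simp: D_def)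
  then have D_fin: "emeasure M D < \<infinity>"
    using assms by (auto simp: less_top[symmetric] top_unique)
  have "(LINT k : A | M. f k) - (LINT k : B | M. f k)
      = (LINT k | M. indicator A k *\<^sub>R f k - indicator B k *\<^sub>R f k)"
    using f by (simp add: set_lebesgue_integral_def set_integrable_def)
  also have "norm \<dots> \<le> (LINT k | M. C * indicator D k)"
  proof (rule order_trans[OF integral_norm_bound integral_mono])
    show "integrable M (\<lambda>k. norm (indicator A k *\<^sub>R f k - indicator B k *\<^sub>R f k))"
      using f by (simp add: set_integrable_def)
    show "integrable M (\<lambda>k. C * indicator D k :: real)"
      using D D_fin by (intro integrable_mult_right integrable_real_indicator)
    show "norm (indicator A k *\<^sub>R f k - indicator B k *\<^sub>R f k) \<le> C * indicator D k" for k
      using bound[of k] by (auto simp: D_def indicator_def)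
  qed
  also have "\<dots> = C * measure M D"
    using D by (simp add: sets.Int_space_eq2)
  finally show ?thesis by (simp add: D_def)
qed

lemma set_borel_measurable_image:
  assumes "T \<in> measurable M M" "inj T" "set_borel_measurable M (T ` A) f"
  shows "set_borel_measurable M A (\<lambda>k. f (T k))"
proof -
  have "(\<lambda>k. indicator (T ` A) (T k) *\<^sub>R f (T k)) \<in> borel_measurable M"
    using measurable_compose[OF assms(1)] assms(3) unfolding set_borel_measurable_def by blast
  also have "(\<lambda>k. indicator (T ` A) (T k) :: real) = indicator A"
    using \<open>inj T\<close> by (auto simp: indicator_def inj_image_mem_iff)
  finally show ?thesis by (simp add: set_borel_measurable_def)
qed

section \<open>Averages over a space-filling net\<close>

text \<open>The operator norm bound appears pointwise here, and unimodularity is reduced to left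
  invariance of the given measure.\<close>

locale contraction_semigroup =
  fixes \<mu> :: "'g::{topological_group_add, t2_space} measure"
    and K :: "'g set"
    and U :: "'g \<Rightarrow> 'h::complex_hilbert_space \<Rightarrow> 'h"
  assumes right_haar: "right_haar_measure \<mu>" and left_haar: "left_haar_measure \<mu>"
    and semigroup: "\<And>g h. g \<in> K \<Longrightarrow> h \<in> K \<Longrightarrow> g + h \<in> K"
    and K_borel: "K \<in> sets borel"
    and clinear: "\<And>g. g \<in> K \<Longrightarrow> bounded_clinear (U g)"
    and contraction: "\<And>g v. g \<in> K \<Longrightarrow> norm (U g v) \<le> norm v"
    and mult: "\<And>g h v. g \<in> K \<Longrightarrow> h \<in> K \<Longrightarrow> U (g + h) v = U g (U h v)"
    and measurable_coeff:
      "\<And>u v. (\<lambda>g. cinner (U g u) v) \<in> borel_measurable (restrict_space borel K)"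
begin

lemma sets_mu: "sets \<mu> = sets borel"
  using right_haar by (simp add: right_haar_measure_def radon_measure_def)

lemma U_linear:
  assumes "g \<in> K"
  shows "U g (u + v) = U g u + U g v" "U g (u - v) = U g u - U g v" "U g (c *\<^sub>C v) = c *\<^sub>C U g v"
  using clinear[OF assms]
  by (auto simp: bounded_clinear_def bounded_linear.linear linear_add linear_diff)

lemma measurable_add_right: "(\<lambda>k. k + g) \<in> measurable \<mu> \<mu>"
  using borel_measurable_add_right by (simp add: measurable_cong_sets[OF sets_mu sets_mu])

lemma measurable_add_left: "(\<lambda>k. h + k) \<in> measurable \<mu> \<mu>"
  using borel_measurable_add_left by (simp add: measurable_cong_sets[OF sets_mu sets_mu])

lemma coeff_measurable:
  assumes "A \<in> sets borel" "A \<subseteq> K"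
  shows "set_borel_measurable \<mu> A (\<lambda>g. cinner x (U g y))"
proof -
  \<comment> \<open>The measurability hypothesis has \<open>U\<close> in the antilinear slot;
    conjugation moves it to the other one.\<close>
  have "(\<lambda>g. cnj (cinner (U g y) x)) \<in> borel_measurable (restrict_space borel K)"
    using measurable_coeff by (intro borel_measurable_continuous_on[of cnj]) (auto intro: continuous_intros)
  then have "(\<lambda>g. cinner x (U g y)) \<in> borel_measurable (restrict_space borel K)"
    by (simp flip: cinner_commute)
  \<comment> \<open>Since \<open>K\<close> is Borel, extension by zero turns measurability on
    \<open>K\<close> into measurability on the whole group.\<close>
  then have "(\<lambda>g. indicator K g *\<^sub>R cinner x (U g y)) \<in> borel_measurable borel"
    using K_borel by (subst (asm) borel_measurable_restrict_space_iff) auto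
  then have "(\<lambda>g. indicator A g *\<^sub>R indicator K g *\<^sub>R cinner x (U g y)) \<in> borel_measurable borel"
    by (rule borel_measurable_scaleR[OF borel_measurable_indicator[OF assms(1)]])
  also have "(\<lambda>g. indicator A g *\<^sub>R indicator K g *\<^sub>R cinner x (U g y))
      = (\<lambda>g. indicator A g *\<^sub>R cinner x (U g y))"
    using \<open>A \<subseteq> K\<close> by (intro ext) (auto simp: indicator_def)
  finally show ?thesis
    by (simp add: set_borel_measurable_def measurable_cong_sets[OF sets_mu refl])
qed

lemma coeff_bound: "g \<in> K \<Longrightarrow> cmod (cinner x (U g v)) \<le> norm x * norm v"
  by (meson cinner_cauchy_schwarz contraction mult_left_mono norm_ge_zero order_trans)

text \<open>The integrand is a coefficient on the left translate of \<open>A\<close> by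
  \<open>h\<close>, pulled back to \<open>A\<close>; it is bounded on a set of finite
  measure.\<close>

lemma shifted_coeff_integrable:
  assumes "h \<in> K" "A \<in> sets borel" "A \<subseteq> K" "emeasure \<mu> A < \<infinity>"
  shows "set_integrable \<mu> A (\<lambda>g. cinner x (U (h + g) v))"
proof -
  have "(\<lambda>k. h + k) ` A \<subseteq> K"
    using assms semigroup by auto
  then have "set_borel_measurable \<mu> A (\<lambda>g. cinner x (U (h + g) v))"
    using assms
    by (intro set_borel_measurable_image[where T = "\<lambda>k. h + k" and f = "\<lambda>g. cinner x (U g v)"]
        measurable_add_left coeff_measurable sets_borel_add_left) (auto simp: inj_def)
  moreover have "cmod (cinner x (U (h + g) v)) \<le> norm x * norm v" if "g \<in> A" for g
    using that assms by (intro coeff_bound semigroup) auto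
  ultimately show ?thesis
    unfolding set_integrable_def set_borel_measurable_def
    using assms by (intro integrableI_bounded_set[where A = A and B = "norm x * norm v"])
      (auto simp: sets_mu)
qed

lemma shifted_coeff_integral_bound:
  assumes "h \<in> K" "A \<in> sets borel" "A \<subseteq> K" "emeasure \<mu> A < \<infinity>"
  shows "cmod (LINT g : A | \<mu>. cinner x (U (h + g) v)) \<le> norm x * norm v * measure \<mu> A"
proof -
  \<comment> \<open>This is the symmetric difference estimate with the empty set as second
    set.\<close>
  have "cmod ((LINT g : A | \<mu>. cinner x (U (h + g) v)) - (LINT g : {} | \<mu>. cinner x (U (h + g) v)))
      \<le> norm x * norm v * measure \<mu> ((A \<union> {}) - (A \<inter> {}))"
    using assms shifted_coeff_integrable[OF assms]
    by (intro set_integral_diff_le_symm_diff coeff_bound semigroup) (auto simp: sets_mu set_integrable_def)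
  then show ?thesis by (simp add: set_lebesgue_integral_def)
qed

text \<open>The semigroup law gives U (h + g) (U k v) = U (h + (g + k)) v, so right invariance turns
  the integral for \<open>U k v\<close> into the one for \<open>v\<close> over the right translate
  of \<open>A\<close>. The bound is free of \<open>h\<close> because all coefficients on
  \<open>K\<close> obey the same estimate.\<close>

lemma coboundary_integral_bound:
  assumes "h \<in> K" "k \<in> K" and A: "A \<in> sets borel" "A \<subseteq> K" "emeasure \<mu> A < \<infinity>"
  shows "cmod (LINT g : A | \<mu>. cinner x (U (h + g) (v - U k v)))
    \<le> norm x * norm v * measure \<mu> ((A \<union> (\<lambda>g. g + k) ` A) - (A \<inter> (\<lambda>g. g + k) ` A))"
proof -
  let ?B = "(\<lambda>g. g + k) ` A" and ?f = "\<lambda>g. cinner x (U (h + g) v)"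
  have B: "?B \<in> sets borel" "?B \<subseteq> K" "emeasure \<mu> ?B < \<infinity>"
    using A \<open>k \<in> K\<close> semigroup sets_borel_add_right right_haar
    by (auto simp: right_haar_measure_def)
  have int: "set_integrable \<mu> A ?f" "set_integrable \<mu> ?B ?f"
    using assms B by (auto intro: shifted_coeff_integrable)
  have meas: "set_borel_measurable \<mu> ?B ?f"
    using int(2) by (simp add: set_integrable_def set_borel_measurable_def)
  have intU: "set_integrable \<mu> A (\<lambda>g. cinner x (U (h + g) (U k v)))"
    using assms by (intro shifted_coeff_integrable)
  have "(LINT g : ?B | \<mu>. ?f g) = (LINT g : A | \<mu>. ?f (g + k))"
    using B meas
    by (intro set_integral_image_measure_preserving distr_add_right right_haar measurable_add_right)
      (auto simp: inj_def sets_mu)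
  also have "\<dots> = (LINT g : A | \<mu>. cinner x (U (h + g) (U k v)))"
  proof (rule set_lebesgue_integral_cong)
    show "\<forall>g. g \<in> A \<longrightarrow> ?f (g + k) = cinner x (U (h + g) (U k v))"
      using assms semigroup by (auto simp flip: mult simp: add.assoc)
  qed (use A in \<open>simp add: sets_mu\<close>)
  finally have eq: "(LINT g : A | \<mu>. ?f g) - (LINT g : ?B | \<mu>. ?f g)
      = (LINT g : A | \<mu>. ?f g - cinner x (U (h + g) (U k v)))"
    using int intU by simp
  also have "\<dots> = (LINT g : A | \<mu>. cinner x (U (h + g) (v - U k v)))"
    using assms semigroup
    by (intro set_lebesgue_integral_cong) (auto simp: sets_mu U_linear cinner_diff_right)
  finally show ?thesis
    using set_integral_diff_le_symm_diff[of A \<mu> ?B ?f "norm x * norm v"] A B int assms semigroup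
    by (auto simp: sets_mu intro!: coeff_bound)
qed

definition fixed_vectors :: "'h set"
  where "fixed_vectors = {z. \<forall>g\<in>K. U g z = z}"

lemma shifted_integral_add:
  assumes "h \<in> K" "A \<in> sets borel" "A \<subseteq> K" "emeasure \<mu> A < \<infinity>"
  shows "(LINT g : A | \<mu>. cinner x (U (h + g) (u + v)))
    = (LINT g : A | \<mu>. cinner x (U (h + g) u)) + (LINT g : A | \<mu>. cinner x (U (h + g) v))"
proof -
  have "(LINT g : A | \<mu>. cinner x (U (h + g) (u + v)))
      = (LINT g : A | \<mu>. cinner x (U (h + g) u) + cinner x (U (h + g) v))"
    using assms semigroup
    by (intro set_lebesgue_integral_cong) (auto simp: sets_mu U_linear cinner_add_right)
  then show ?thesis
    using assms by (simp add: shifted_coeff_integrable)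
qed

lemma shifted_integral_scaleC:
  assumes "h \<in> K" "A \<in> sets borel" "A \<subseteq> K"
  shows "(LINT g : A | \<mu>. cinner x (U (h + g) (c *\<^sub>C v)))
    = c * (LINT g : A | \<mu>. cinner x (U (h + g) v))"
proof -
  have "(LINT g : A | \<mu>. cinner x (U (h + g) (c *\<^sub>C v)))
      = (LINT g : A | \<mu>. c * cinner x (U (h + g) v))"
    using assms semigroup
    by (intro set_lebesgue_integral_cong) (auto simp: sets_mu U_linear cinner_scaleC_right)
  then show ?thesis by simp
qed

lemma shifted_integral_fixed:
  assumes "h \<in> K" "A \<in> sets borel" "A \<subseteq> K" "emeasure \<mu> A < \<infinity>" "p \<in> fixed_vectors"
  shows "(LINT g : A | \<mu>. cinner x (U (h + g) p)) = cinner x p * measure \<mu> A"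
proof -
  have "(LINT g : A | \<mu>. cinner x (U (h + g) p)) = (LINT g : A | \<mu>. cinner x p)"
    using assms semigroup
    by (intro set_lebesgue_integral_cong) (auto simp: sets_mu fixed_vectors_def)
  also have "\<dots> = cinner x p * measure \<mu> A"
    using assms by (simp add: set_lebesgue_integral_def sets_mu scaleR_conv_of_real)
  finally show ?thesis .
qed

end

section \<open>Vectors whose translated averages tend to 0 uniformly\<close>

locale space_filling_family = contraction_semigroup \<mu> K U
  for \<mu> :: "'g::{topological_group_add, t2_space} measure"
    and K and U :: "'g \<Rightarrow> 'h::complex_hilbert_space \<Rightarrow> 'h" +
  fixes F :: "'i filter" and \<Lambda> :: "'i \<Rightarrow> 'g set" and x :: 'h
  assumes \<Lambda>: "\<forall>\<^sub>F \<alpha> in F. \<Lambda> \<alpha> \<in> sets borel \<and> \<Lambda> \<alpha> \<subseteq> K \<and> emeasure \<mu> (\<Lambda> \<alpha>) < \<infinity>"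
    and \<Lambda>_pos: "\<forall>\<^sub>F \<alpha> in F. measure \<mu> (\<Lambda> \<alpha>) > 0"
    and almost_invariant: "\<And>g. g \<in> K \<Longrightarrow>
      ((\<lambda>\<alpha>. measure \<mu> ((\<Lambda> \<alpha> \<union> (\<lambda>k. k + g) ` \<Lambda> \<alpha>) - (\<Lambda> \<alpha> \<inter> (\<lambda>k. k + g) ` \<Lambda> \<alpha>))
        / measure \<mu> (\<Lambda> \<alpha>)) \<longlongrightarrow> 0) F"
begin

text \<open>The estimate is uniform in the shift \<open>h\<close>, which is what makes a single index work for all
  translates of a set of the net.\<close>

definition mean_null :: "'h \<Rightarrow> bool"
  where "mean_null w \<longleftrightarrow> (\<forall>e>0. \<forall>\<^sub>F \<alpha> in F. \<forall>h\<in>K.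
    cmod (LINT g : \<Lambda> \<alpha> | \<mu>. cinner x (U (h + g) w)) \<le> e * measure \<mu> (\<Lambda> \<alpha>))"

lemma mean_null_add:
  assumes "mean_null u" "mean_null v"
  shows "mean_null (u + v)"
  unfolding mean_null_def
proof (intro allI impI)
  fix e :: real assume "e > 0"
  then have "e / 2 > 0" by simp
  with assms have "\<forall>\<^sub>F \<alpha> in F. \<forall>h\<in>K.
      cmod (LINT g : \<Lambda> \<alpha> | \<mu>. cinner x (U (h + g) u)) \<le> e / 2 * measure \<mu> (\<Lambda> \<alpha>)"
    and "\<forall>\<^sub>F \<alpha> in F. \<forall>h\<in>K.
      cmod (LINT g : \<Lambda> \<alpha> | \<mu>. cinner x (U (h + g) v)) \<le> e / 2 * measure \<mu> (\<Lambda> \<alpha>)"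
    unfolding mean_null_def by blast+
  with \<Lambda> show "\<forall>\<^sub>F \<alpha> in F. \<forall>h\<in>K.
      cmod (LINT g : \<Lambda> \<alpha> | \<mu>. cinner x (U (h + g) (u + v))) \<le> e * measure \<mu> (\<Lambda> \<alpha>)"
  proof eventually_elim
    case (elim \<alpha>)
    show ?case
    proof
      fix h assume "h \<in> K"
      have "cmod (LINT g : \<Lambda> \<alpha> | \<mu>. cinner x (U (h + g) (u + v)))
          \<le> cmod (LINT g : \<Lambda> \<alpha> | \<mu>. cinner x (U (h + g) u))
            + cmod (LINT g : \<Lambda> \<alpha> | \<mu>. cinner x (U (h + g) v))"
        using elim(1) \<open>h \<in> K\<close> by (simp add: shifted_integral_add norm_triangle_ineq)
      also have "\<dots> \<le> e / 2 * measure \<mu> (\<Lambda> \<alpha>) + e / 2 * measure \<mu> (\<Lambda> \<alpha>)"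
        using elim \<open>h \<in> K\<close> by (intro add_mono) auto
      finally show "cmod (LINT g : \<Lambda> \<alpha> | \<mu>. cinner x (U (h + g) (u + v))) \<le> e * measure \<mu> (\<Lambda> \<alpha>)"
        by simp
    qed
  qed
qed

lemma mean_null_scaleC:
  assumes "mean_null v"
  shows "mean_null (c *\<^sub>C v)"
  unfolding mean_null_def
proof (intro allI impI)
  fix e :: real assume "e > 0"
  \<comment> \<open>The added 1 keeps the denominator positive when \<open>c\<close> is 0.\<close>
  then have "e / (cmod c + 1) > 0" by (simp add: add_nonneg_pos)
  with assms have "\<forall>\<^sub>F \<alpha> in F. \<forall>h\<in>K.
      cmod (LINT g : \<Lambda> \<alpha> | \<mu>. cinner x (U (h + g) v)) \<le> e / (cmod c + 1) * measure \<mu> (\<Lambda> \<alpha>)"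
    unfolding mean_null_def by blast
  with \<Lambda> show "\<forall>\<^sub>F \<alpha> in F. \<forall>h\<in>K.
      cmod (LINT g : \<Lambda> \<alpha> | \<mu>. cinner x (U (h + g) (c *\<^sub>C v))) \<le> e * measure \<mu> (\<Lambda> \<alpha>)"
  proof eventually_elim
    case (elim \<alpha>)
    show ?case
    proof
      fix h assume "h \<in> K"
      have "cmod (LINT g : \<Lambda> \<alpha> | \<mu>. cinner x (U (h + g) (c *\<^sub>C v)))
          = cmod c * cmod (LINT g : \<Lambda> \<alpha> | \<mu>. cinner x (U (h + g) v))"
        using elim(1) \<open>h \<in> K\<close> by (simp add: shifted_integral_scaleC norm_mult)
      also have "\<dots> \<le> (cmod c + 1) * (e / (cmod c + 1) * measure \<mu> (\<Lambda> \<alpha>))"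
        using elim \<open>h \<in> K\<close> by (intro mult_mono) auto
      also have "\<dots> = e * measure \<mu> (\<Lambda> \<alpha>)"
        using \<open>e / (cmod c + 1) > 0\<close> by auto
      finally show "cmod (LINT g : \<Lambda> \<alpha> | \<mu>. cinner x (U (h + g) (c *\<^sub>C v))) \<le> e * measure \<mu> (\<Lambda> \<alpha>)" .
    qed
  qed
qed

text \<open>The error \<open>l - w n\<close> contributes at most ||x|| ||l - w n|| to every average,
  whatever \<open>h\<close> and the index are. So a single \<open>n\<close> can be fixed before
  passing along the net.\<close>

lemma mean_null_limit:
  assumes "\<And>n. mean_null (w n)" "w \<longlonglongrightarrow> l"
  shows "mean_null l"
  unfolding mean_null_def
proof (intro allI impI)
  fix e :: real assume "e > 0"
  have "(\<lambda>n. norm x * norm (l - w n)) \<longlonglongrightarrow> norm x * norm (l - l)"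
    using assms by (intro tendsto_intros)
  then have "\<forall>\<^sub>F n in sequentially. norm x * norm (l - w n) < e / 2"
    using \<open>e > 0\<close> by (intro order_tendstoD) auto
  then obtain n where n: "norm x * norm (l - w n) < e / 2"
    by (auto simp: eventually_sequentially)
  have "e / 2 > 0" using \<open>e > 0\<close> by simp
  with assms have "\<forall>\<^sub>F \<alpha> in F. \<forall>h\<in>K.
      cmod (LINT g : \<Lambda> \<alpha> | \<mu>. cinner x (U (h + g) (w n))) \<le> e / 2 * measure \<mu> (\<Lambda> \<alpha>)"
    unfolding mean_null_def by blast
  with \<Lambda> show "\<forall>\<^sub>F \<alpha> in F. \<forall>h\<in>K.
      cmod (LINT g : \<Lambda> \<alpha> | \<mu>. cinner x (U (h + g) l)) \<le> e * measure \<mu> (\<Lambda> \<alpha>)"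
  proof eventually_elim
    case (elim \<alpha>)
    show ?case
    proof
      fix h assume "h \<in> K"
      have "cmod (LINT g : \<Lambda> \<alpha> | \<mu>. cinner x (U (h + g) l))
          = cmod (LINT g : \<Lambda> \<alpha> | \<mu>. cinner x (U (h + g) (w n + (l - w n))))"
        by simp
      also have "\<dots> \<le> cmod (LINT g : \<Lambda> \<alpha> | \<mu>. cinner x (U (h + g) (w n)))
            + cmod (LINT g : \<Lambda> \<alpha> | \<mu>. cinner x (U (h + g) (l - w n)))"
        using elim(1) \<open>h \<in> K\<close> by (simp only: shifted_integral_add norm_triangle_ineq)
      also have "\<dots> \<le> e / 2 * measure \<mu> (\<Lambda> \<alpha>) + norm x * norm (l - w n) * measure \<mu> (\<Lambda> \<alpha>)"
        using elim \<open>h \<in> K\<close> by (intro add_mono shifted_coeff_integral_bound) auto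
      also have "\<dots> \<le> e / 2 * measure \<mu> (\<Lambda> \<alpha>) + e / 2 * measure \<mu> (\<Lambda> \<alpha>)"
        using n by (intro add_left_mono mult_right_mono) auto
      finally show "cmod (LINT g : \<Lambda> \<alpha> | \<mu>. cinner x (U (h + g) l)) \<le> e * measure \<mu> (\<Lambda> \<alpha>)"
        by simp
    qed
  qed
qed

lemma mean_null_zero: "mean_null 0"
  unfolding mean_null_def
proof (intro allI impI)
  fix e :: real assume "e > 0"
  from \<Lambda> show "\<forall>\<^sub>F \<alpha> in F. \<forall>h\<in>K.
      cmod (LINT g : \<Lambda> \<alpha> | \<mu>. cinner x (U (h + g) 0)) \<le> e * measure \<mu> (\<Lambda> \<alpha>)"
  proof eventually_elim
    case (elim \<alpha>)
    then show ?case
      using shifted_coeff_integral_bound[of _ "\<Lambda> \<alpha>" x 0] \<open>e > 0\<close> by simp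
  qed
qed

lemma mean_null_coboundary:
  assumes "k \<in> K"
  shows "mean_null (v - U k v)"
  unfolding mean_null_def
proof (intro allI impI)
  fix e :: real assume "e > 0"
  define D where "D \<alpha> = (\<Lambda> \<alpha> \<union> (\<lambda>g. g + k) ` \<Lambda> \<alpha>) - (\<Lambda> \<alpha> \<inter> (\<lambda>g. g + k) ` \<Lambda> \<alpha>)" for \<alpha>
  have "((\<lambda>\<alpha>. norm x * norm v * (measure \<mu> (D \<alpha>) / measure \<mu> (\<Lambda> \<alpha>))) \<longlongrightarrow> 0) F"
    unfolding D_def by (intro tendsto_mult_right_zero almost_invariant assms)
  then have "\<forall>\<^sub>F \<alpha> in F. norm x * norm v * (measure \<mu> (D \<alpha>) / measure \<mu> (\<Lambda> \<alpha>)) < e"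
    using \<open>e > 0\<close> by (rule order_tendstoD)
  with \<Lambda> \<Lambda>_pos show "\<forall>\<^sub>F \<alpha> in F. \<forall>h\<in>K.
      cmod (LINT g : \<Lambda> \<alpha> | \<mu>. cinner x (U (h + g) (v - U k v))) \<le> e * measure \<mu> (\<Lambda> \<alpha>)"
  proof eventually_elim
    case (elim \<alpha>)
    \<comment> \<open>Positivity of the measure of \<open>\<Lambda> \<alpha>\<close> allows clearing
      the denominator.\<close>
    then have "norm x * norm v * measure \<mu> (D \<alpha>) \<le> e * measure \<mu> (\<Lambda> \<alpha>)"
      by (simp add: field_simps)
    then show ?case
      using elim(1) assms
      by (auto simp: D_def intro: order_trans[OF coboundary_integral_bound])
  qed
qed

text \<open>The vector \<open>y\<close> is projected not onto the fixed vectors but onto the space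
  \<open>M\<close> of mean-null vectors orthogonal to them. All coboundaries lie in
  \<open>M\<close>, so the remainder is orthogonal to them and hence fixed; this avoids proving
  separately that the coboundaries span a dense part of the complement.\<close>

lemma fixed_decomposition:
  obtains p w where "y = p + w" "p \<in> fixed_vectors" "mean_null w"
    "orthogonal_projection fixed_vectors y = p"
proof -
  define M where "M = {w. mean_null w \<and> (\<forall>v\<in>fixed_vectors. cinner v w = 0)}"
  have coboundary: "v - U k v \<in> M" if "k \<in> K" for v k
  proof -
    have "cinner u (v - U k v) = 0" if "u \<in> fixed_vectors" for u
    proof (rule contraction_fixed_orthogonal[where T = "U k"])
      show "U k u = u" using that \<open>k \<in> K\<close> by (simp add: fixed_vectors_def)
    qed (rule clinear contraction \<open>k \<in> K\<close>)+
    then show ?thesis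
      using mean_null_coboundary[OF that] by (simp add: M_def)
  qed
  have "closed M"
    unfolding closed_sequential_limits
  proof (intro allI impI, elim conjE)
    fix w l assume w: "\<forall>n. w n \<in> M" "w \<longlonglongrightarrow> l"
    have "cinner v l = 0" if "v \<in> fixed_vectors" for v
    proof -
      have "(\<lambda>n. cinner v (w n)) \<longlonglongrightarrow> cinner v l"
        using w by (intro tendsto_cinner_right)
      moreover have "cinner v (w n) = 0" for n
        using w that by (simp add: M_def)
      ultimately show ?thesis by (simp add: LIMSEQ_const_iff)
    qed
    then show "l \<in> M"
      using w mean_null_limit[of w l] by (simp add: M_def)
  qed
  moreover have "0 \<in> M"
    by (simp add: M_def mean_null_zero)
  moreover have "u + v \<in> M" if "u \<in> M" "v \<in> M" for u v
    using that by (simp add: M_def mean_null_add cinner_add_right)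
  moreover have "c *\<^sub>C v \<in> M" if "v \<in> M" for c v
    using that by (simp add: M_def mean_null_scaleC cinner_scaleC_right)
  ultimately obtain w where w: "w \<in> M" "\<And>m. m \<in> M \<Longrightarrow> cinner m (y - w) = 0"
    using closed_subspace_projection[of M y] by metis
  define p where "p = y - w"
  have "U k p = p" if "k \<in> K" for k
  proof (rule contraction_fixed_if_orthogonal[where T = "U k"])
    \<comment> \<open>The coboundary of \<open>p\<close> itself lies in \<open>M\<close>, to which
      \<open>p\<close> is orthogonal.\<close>
    have "cinner (p - U k p) p = 0"
      using w(2)[OF coboundary[OF that]] by (simp add: p_def)
    then show "cinner p (p - U k p) = 0"
      by (subst cinner_commute) simp
  qed (rule contraction[OF that])
  then have p: "p \<in> fixed_vectors" by (simp add: fixed_vectors_def)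
  have "orthogonal_projection fixed_vectors y = p"
  proof (rule orthogonal_projection_eqI)
    \<comment> \<open>Here \<open>y - p\<close> is \<open>w\<close>, and orthogonality to the fixed
      vectors is built into \<open>M\<close>.\<close>
    show "cinner v (y - p) = 0" if "v \<in> fixed_vectors" for v
      using w(1) that by (simp add: p_def M_def)
    show "u - v \<in> fixed_vectors" if "u \<in> fixed_vectors" "v \<in> fixed_vectors" for u v
      using that by (simp add: fixed_vectors_def U_linear)
  qed (rule p)
  with p w(1) show thesis
    by (intro that[of p w]) (auto simp: p_def M_def)
qed

lemma translated_average_lower_bound:
  assumes "\<epsilon> > 0"
  shows "\<forall>\<^sub>F \<alpha> in F. \<forall>h\<in>K. cmod (complex_of_real (1 / measure \<mu> (\<Lambda> \<alpha>)) *
        (LINT g : (\<lambda>k. h + k) ` \<Lambda> \<alpha> | \<mu>. cinner x (U g y)))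
      > cmod (cinner x (orthogonal_projection fixed_vectors y)) - \<epsilon>"
proof -
  obtain p w where pw: "y = p + w" "p \<in> fixed_vectors" "mean_null w"
    and proj: "orthogonal_projection fixed_vectors y = p"
    by (rule fixed_decomposition)
  \<comment> \<open>Half of \<epsilon> is used because the bound in \<open>mean_null\<close> is not
    strict while the conclusion is.\<close>
  have "\<forall>\<^sub>F \<alpha> in F. \<forall>h\<in>K.
      cmod (LINT g : \<Lambda> \<alpha> | \<mu>. cinner x (U (h + g) w)) \<le> \<epsilon> / 2 * measure \<mu> (\<Lambda> \<alpha>)"
    using pw(3) half_gt_zero[OF assms] unfolding mean_null_def by blast
  with \<Lambda> \<Lambda>_pos show ?thesis
  proof eventually_elim
    case (elim \<alpha>)
    define m where "m = measure \<mu> (\<Lambda> \<alpha>)"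
    have "m > 0" using elim by (simp add: m_def)
    show ?case
    proof
      fix h assume h: "h \<in> K"
      define J where "J = (LINT g : \<Lambda> \<alpha> | \<mu>. cinner x (U (h + g) w))"
      have "(\<lambda>k. h + k) ` \<Lambda> \<alpha> \<subseteq> K"
        using elim h semigroup by auto
      \<comment> \<open>Left invariance moves the shift by \<open>h\<close> from the set into the
        operator.\<close>
      then have "(LINT g : (\<lambda>k. h + k) ` \<Lambda> \<alpha> | \<mu>. cinner x (U g y))
          = (LINT g : \<Lambda> \<alpha> | \<mu>. cinner x (U (h + g) y))"
        using elim h sets_borel_add_left
        by (intro set_integral_image_measure_preserving distr_add_left left_haar
            measurable_add_left coeff_measurable) (auto simp: inj_def sets_mu)
      also have "\<dots> = cinner x p * m + J"
        using elim h pw by (simp add: shifted_integral_add shifted_integral_fixed m_def J_def)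
      finally have "complex_of_real (1 / m) * (LINT g : (\<lambda>k. h + k) ` \<Lambda> \<alpha> | \<mu>. cinner x (U g y))
          = cinner x p + J / m"
        using \<open>m > 0\<close> by (simp add: field_simps)
      moreover have "cmod (J / m) \<le> \<epsilon> / 2"
        using elim h \<open>m > 0\<close> by (simp add: J_def m_def norm_divide field_simps)
      moreover have "cmod (cinner x p) - cmod (J / m) \<le> cmod (cinner x p + J / m)"
        by (rule norm_diff_ineq)
      ultimately show "cmod (complex_of_real (1 / measure \<mu> (\<Lambda> \<alpha>)) *
          (LINT g : (\<lambda>k. h + k) ` \<Lambda> \<alpha> | \<mu>. cinner x (U g y)))
        > cmod (cinner x (orthogonal_projection fixed_vectors y)) - \<epsilon>"
        using \<open>\<epsilon> > 0\<close> unfolding proj m_def[symmetric] by simp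
    qed
  qed
qed

end

section \<open>From the filter back to an index of the net\<close>

theorem theorem2p2:
  fixes \<mu> :: "'g::{topological_group_add, t2_space} measure"
    and K :: "'g set"
    and U :: "'g \<Rightarrow> 'h::complex_hilbert_space \<Rightarrow> 'h"
    and I :: "'i set" and r :: "'i rel" and \<Lambda> :: "'i \<Rightarrow> 'g set"
    and x y :: 'h and \<epsilon> :: real
  defines "V \<equiv> {z. \<forall>g\<in>K. U g z = z}"
  assumes "locally_compact_space (euclidean :: 'g topology)"
    and "unimodular TYPE('g)"
    and "right_haar_measure \<mu>"
    and "subsemigroup K" and "K \<in> sets borel"
    and "\<And>g. g \<in> K \<Longrightarrow> bounded_clinear (U g)"
    and "\<And>g. g \<in> K \<Longrightarrow> onorm (U g) \<le> 1"
    and "\<And>g h. g \<in> K \<Longrightarrow> h \<in> K \<Longrightarrow> U g \<circ> U h = U (g + h)"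
    and "\<And>u v. (\<lambda>g. cinner (U g u) v) \<in> borel_measurable (restrict_space borel K)"
    and "space_filling \<mu> K I r \<Lambda>"
    and "\<epsilon> > 0"
  shows "\<exists>\<alpha>\<^sub>0\<in>I. measure \<mu> (\<Lambda> \<alpha>\<^sub>0) > 0 \<and>
    (\<forall>h\<in>K. cmod (complex_of_real (1 / measure \<mu> (\<Lambda> \<alpha>\<^sub>0)) *
        (LINT g : (\<lambda>k. h + k) ` \<Lambda> \<alpha>\<^sub>0 | \<mu>. cinner x (U g y)))
      > cmod (cinner x (orthogonal_projection V y)) - \<epsilon>)"
proof -
  have directed: "directed_set I r"
    and \<Lambda>: "\<And>\<alpha>. \<alpha> \<in> I \<Longrightarrow> \<Lambda> \<alpha> \<in> sets borel \<and> \<Lambda> \<alpha> \<subseteq> K \<and> emeasure \<mu> (\<Lambda> \<alpha>) < \<infinity>"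
    and pos: "\<forall>\<^sub>F \<alpha> in net_filter I r. emeasure \<mu> (\<Lambda> \<alpha>) > 0"
    using assms(11) by (auto simp: space_filling_def)
  have ev_I: "\<forall>\<^sub>F \<alpha> in net_filter I r. \<alpha> \<in> I"
    unfolding eventually_net_filter[OF directed] using directed by (auto simp: directed_set_def)
  \<comment> \<open>Finiteness matters here: \<open>measure\<close> assigns 0 to sets of infinite
    measure.\<close>
  have pos': "\<forall>\<^sub>F \<alpha> in net_filter I r. measure \<mu> (\<Lambda> \<alpha>) > 0"
    using ev_I pos by eventually_elim (use \<Lambda> in \<open>auto simp: measure_def enn2real_positive_iff\<close>)
  interpret space_filling_family \<mu> K U "net_filter I r" \<Lambda> x
  proof
    show "left_haar_measure \<mu>" using assms by (simp add: unimodular_def)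
    show "norm (U g v) \<le> norm v" if "g \<in> K" for g v
    proof -
      have "norm (U g v) \<le> onorm (U g) * norm v"
        using assms(7)[OF that] by (intro onorm) (simp add: bounded_clinear_def)
      also have "\<dots> \<le> 1 * norm v" using assms(8)[OF that] by (intro mult_right_mono) auto
      finally show ?thesis by simp
    qed
    show "U (g + h) v = U g (U h v)" if "g \<in> K" "h \<in> K" for g h v
      using assms(9)[OF that] by (metis comp_apply)
    show "\<forall>\<^sub>F \<alpha> in net_filter I r. \<Lambda> \<alpha> \<in> sets borel \<and> \<Lambda> \<alpha> \<subseteq> K \<and> emeasure \<mu> (\<Lambda> \<alpha>) < \<infinity>"
      using ev_I by eventually_elim (rule \<Lambda>)
  qed (use assms pos' in \<open>auto simp: subsemigroup_def space_filling_def\<close>)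
  have "V = fixed_vectors" by (simp add: V_def fixed_vectors_def)
  with ev_I pos' translated_average_lower_bound[OF \<open>\<epsilon> > 0\<close>, of y]
  have "\<forall>\<^sub>F \<alpha> in net_filter I r. \<alpha> \<in> I \<and> measure \<mu> (\<Lambda> \<alpha>) > 0 \<and>
      (\<forall>h\<in>K. cmod (complex_of_real (1 / measure \<mu> (\<Lambda> \<alpha>)) *
        (LINT g : (\<lambda>k. h + k) ` \<Lambda> \<alpha> | \<mu>. cinner x (U g y)))
      > cmod (cinner x (orthogonal_projection V y)) - \<epsilon>)"
    by (simp add: eventually_conj_iff)
  \<comment> \<open>The property holds at all indices beyond some index of \<open>I\<close>; by
    reflexivity it holds at that index, which serves as the witness.\<close>
  then show ?thesis
    unfolding eventually_net_filter[OF directed]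
    using directed by (fastforce simp: directed_set_def preorder_on_def refl_on_def)
qed

end
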